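(* Let $p\ge 1$ be an integer and $L>0$. Let $F:\mathbb{R}^d\to\mathbb{R}^d$ be monotone and $p$-th-order Lipschitz continuous with constant $L$, and suppose that $F(x)=0$ has at least one solution. Let the constant $\eta_1=\eta_1(p,L)$ satisfy $$\frac{p!}{(12p-6)L}\le \eta_1\le\frac{p!}{(4p+2)L}.$$ Then for any $x_0\in\mathbb{R}^d$ the iterates $\{x_k\}_{k\ge 0}$ generated by the high-order method described in the context satisfy $$\inf_{0\le i\le k}\|F(x_i)\| = O(k^{-p/2}),$$ i.e., there is a constant $C>0$ independent of $k$ with $\inf_{0\le i\le k}\|F(x_i)\|\le C k^{-p/2}$ for all $k\ge 1$.
   Context: $\|\cdot\|$ is the Euclidean norm (and the operator norm for multilinear maps). $F$ is monotone if $\langle F(x)-F(y),x-y\rangle\ge0$ for all $x,y$. $D^{(j)}F(x)$ is the $j$-th derivative of $F$ at $x$, with $D^{(0)}F=F$; $D^{(j)}F(v)[h]^j\in\mathbb{R}^d$ denotes its value at $(h,\ldots,h)$. $F$ is $p$-th-order Lipschitz continuous with constant $L$ if it is $(p-1)$ times differentiable and $\|D^{(p-1)}F(x')-D^{(p-1)}F(x)\|\le L\|x'-x\|$ for all $x,x'$. For $v\in\mathbb{R}^d$ define $$F_v(x)=F(v)+DF(v)[x-v]+\cdots+\tfrac{1}{(p-1)!}D^{(p-1)}F(v)[x-v]^{p-1}+\tfrac{2L}{(p-1)!}\|x-v\|^{p-1}(x-v).$$ High-order method: given $x_0\in\mathbb{R}^d$, set $s_0=0$. For $k=0,1,2,\ldots$: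 if $F(x_k)=0$, stop; otherwise set $v_{k+1}=x_0+s_k$; let $x_{k+1}$ be a point with $F_{v_{k+1}}(x_{k+1})=0$ (an oracle returning such an exact solution is assumed); set $\lambda_{k+1}=\eta_1/\|x_{k+1}-v_{k+1}\|^{p-1}$ and $s_{k+1}=s_k-\lambda_{k+1}F(x_{k+1})$. Conventions: if the method stops at $x_j$ with $F(x_j)=0$, the infimum for $k\ge j$ is taken over $x_0,\ldots,x_j$ (so it is $0$). If $x_{k+1}=v_{k+1}$ then $F(x_{k+1})=0$ and the method stops at $x_{k+1}$. For $p=1$, $\|x_{k+1}-v_{k+1}\|^{p-1}=1$. *)

theory Defs
  imports "HOL-Analysis.Analysis" "HOL-Library.Extended_Nat"
begin

definition monotone_operator :: "('a::real_inner \<Rightarrow> 'a) \<Rightarrow> bool" where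
  "monotone_operator F \<longleftrightarrow> (\<forall>x y. inner (F x - F y) (x - y) \<ge> 0)"

(* The order of the derivative is the length of the direction list:
   higher_deriv F [h1,...,hj] x is the value of the j-linear map D^(j)F(x) at (h1,...,hj).
   The head h1 is the direction of the last differentiation, as in
   D^(j)F(x)[h1,...,hj] = (D(D^(j-1)F)(x)[h1])[h2,...,hj]. *)
fun higher_deriv ::
  "('a::euclidean_space \<Rightarrow> 'b::euclidean_space) \<Rightarrow> 'a list \<Rightarrow> 'a \<Rightarrow> 'b" where
  "higher_deriv F [] x = F x"
| "higher_deriv F (h # hs) x = frechet_derivative (higher_deriv F hs) (at x) h"

(* Frechet differentiability of the multilinear-map-valued function D^(j)F, for each j < m.
   The space of j-linear maps is finite-dimensional, with the evaluations at fixed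
   arguments hs spanning its dual, so this is differentiability of each evaluation. *)
definition times_differentiable ::
  "nat \<Rightarrow> ('a::euclidean_space \<Rightarrow> 'b::euclidean_space) \<Rightarrow> bool" where
  "times_differentiable m F \<longleftrightarrow>
     (\<forall>j<m. \<forall>hs x. length hs = j \<longrightarrow> higher_deriv F hs differentiable (at x))"

(* The supremum is over a bounded set whenever T is j-linear; for j = 0 it is norm (T []). *)
definition multi_onorm ::
  "nat \<Rightarrow> ('a::euclidean_space list \<Rightarrow> 'b::euclidean_space) \<Rightarrow> real" where
  "multi_onorm j T =
     (SUP hs\<in>{hs. length hs = j \<and> (\<forall>h\<in>set hs. norm h \<le> 1)}. norm (T hs))"

definition order_lipschitz ::
  "nat \<Rightarrow> real \<Rightarrow> ('a::euclidean_space \<Rightarrow> 'b::euclidean_space) \<Rightarrow> bool" where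
  "order_lipschitz p L F \<longleftrightarrow>
     times_differentiable (p - 1) F \<and>
     (\<forall>x x'. multi_onorm (p - 1) (\<lambda>hs. higher_deriv F hs x' - higher_deriv F hs x)
               \<le> L * norm (x' - x))"

definition reg_taylor ::
  "nat \<Rightarrow> real \<Rightarrow> ('a::euclidean_space \<Rightarrow> 'a) \<Rightarrow> 'a \<Rightarrow> 'a \<Rightarrow> 'a" where
  "reg_taylor p L F v x =
     (\<Sum>j<p. (1 / fact j) *\<^sub>R higher_deriv F (replicate j (x - v)) v)
     + (2 * L / fact (p - 1) * norm (x - v) ^ (p - 1)) *\<^sub>R (x - v)"

(* A run of the method from x0.  N is the index at which it stops (F (x N) = 0), or infinity
   if it never stops; the iterates are x i for i \<le> N, and values beyond N are irrelevant.
   The points x (k+1) are arbitrary exact zeros of the model, as returned by the oracle.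
   If x (k+1) = v (k+1) then F (x (k+1)) = 0, so the run stops at k+1 and the value
   of lam (k+1), possibly a division by zero, is never used. *)
definition high_order_run ::
  "nat \<Rightarrow> real \<Rightarrow> real \<Rightarrow> ('a::euclidean_space \<Rightarrow> 'a) \<Rightarrow> 'a \<Rightarrow> enat
    \<Rightarrow> (nat \<Rightarrow> 'a) \<Rightarrow> (nat \<Rightarrow> 'a) \<Rightarrow> (nat \<Rightarrow> 'a) \<Rightarrow> (nat \<Rightarrow> real) \<Rightarrow> bool" where
  "high_order_run p L \<eta> F x0 N x v s lam \<longleftrightarrow>
     x 0 = x0 \<and> s 0 = 0 \<and>
     (\<forall>k. enat k < N \<longrightarrow>
        F (x k) \<noteq> 0 \<and>
        v (Suc k) = x0 + s k \<and>
        reg_taylor p L F (v (Suc k)) (x (Suc k)) = 0 \<and>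
        lam (Suc k) = \<eta> / norm (x (Suc k) - v (Suc k)) ^ (p - 1) \<and>
        s (Suc k) = s k - lam (Suc k) *\<^sub>R F (x (Suc k))) \<and>
     (\<forall>n. N = enat n \<longrightarrow> F (x n) = 0)"

end

(* Write d = x(k+1) - v(k+1), r = norm d and g = lam(k+1) F(x(k+1)).  Taylor's theorem turns
   "x(k+1) is a zero of the model" into norm (F(x(k+1)) + 2L/(p-1)! r^(p-1) d) <= L/(p-1)! r^p,
   and the choice of lam(k+1) then gives norm (g + d) <= (11/12) r: the method is an inexact
   proximal point method.  Monotonicity makes the squared distance of v(k+1) to a zero of F drop by
   a fixed multiple of r^2 in every step, so the r^2 are summable and the least of the first k
   values of r is O(k^(-1/2)).  Finally norm (F(x(k+1))) <= 3L/(p-1)! r^p. *)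
theory Submission
  imports Defs
begin

section \<open>Multilinear maps on lists of arguments\<close>

text \<open>Arguments form a list, as in \<open>higher_deriv\<close>, and the split
  \<open>as @ h # bs\<close> picks one slot. Lists of length other than \<open>n\<close> are
  unconstrained.\<close>

definition multilinear_on_lists :: "nat \<Rightarrow> ('a::real_vector list \<Rightarrow> 'b::real_vector) \<Rightarrow> bool" where
  "multilinear_on_lists n T \<longleftrightarrow>
     (\<forall>as bs. length as + length bs + 1 = n \<longrightarrow> linear (\<lambda>h. T (as @ h # bs)))"

lemma multilinear_on_lists_head:
  assumes "multilinear_on_lists (Suc n) T" and "length hs = n"
  shows "linear (\<lambda>h. T (h # hs))"
proof -
  have "length [] + length hs + 1 = Suc n" using assms(2) by simp
  then have "linear (\<lambda>h. T ([] @ h # hs))"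
    using assms(1) unfolding multilinear_on_lists_def by blast
  then show ?thesis by simp
qed

lemma multilinear_on_lists_tail:
  assumes "multilinear_on_lists (Suc n) T"
  shows "multilinear_on_lists n (\<lambda>hs. T (a # hs))"
  unfolding multilinear_on_lists_def
proof (intro allI impI)
  fix as bs :: "'a list"
  assume "length as + length bs + 1 = n"
  then have "length (a # as) + length bs + 1 = Suc n" by simp
  then have "linear (\<lambda>h. T ((a # as) @ h # bs))"
    using assms unfolding multilinear_on_lists_def by blast
  then show "linear (\<lambda>h. T (a # as @ h # bs))" by simp
qed

lemma multilinear_on_lists_diff:
  assumes "multilinear_on_lists n S" and "multilinear_on_lists n T"
  shows "multilinear_on_lists n (\<lambda>hs. S hs - T hs)"
  unfolding multilinear_on_lists_def
proof (intro allI impI linear_compose_sub)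
  fix as bs :: "'a list"
  assume "length as + length bs + 1 = n"
  then show "linear (\<lambda>h. S (as @ h # bs))" and "linear (\<lambda>h. T (as @ h # bs))"
    using assms unfolding multilinear_on_lists_def by blast+
qed

lemma multilinear_on_lists_scale:
  assumes "multilinear_on_lists n T"
  shows "T (replicate n (c *\<^sub>R h)) = c ^ n *\<^sub>R T (replicate n h)"
  using assms
proof (induction n arbitrary: T)
  case 0
  then show ?case by simp
next
  case (Suc n)
  have "T (replicate (Suc n) (c *\<^sub>R h)) = c *\<^sub>R T (h # replicate n (c *\<^sub>R h))"
    using linear_scale[OF multilinear_on_lists_head[OF Suc.prems]] by simp
  also have "\<dots> = c *\<^sub>R c ^ n *\<^sub>R T (h # replicate n h)"
    using Suc.IH[OF multilinear_on_lists_tail[OF Suc.prems]] by simp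
  finally show ?case by simp
qed

text \<open>\<open>multi_onorm\<close> is a supremum of reals, so it is an upper bound only once the
  set is known to be bounded. Induction on the number of slots: expand the head in
  \<open>Basis\<close> and bound the finitely many maps whose head is a basis vector.\<close>

lemma multilinear_on_lists_bounded:
  fixes T :: "'a::euclidean_space list \<Rightarrow> 'b::real_normed_vector"
  assumes "multilinear_on_lists n T"
  shows "\<exists>B. \<forall>hs. length hs = n \<and> (\<forall>h\<in>set hs. norm h \<le> 1) \<longrightarrow> norm (T hs) \<le> B"
  using assms
proof (induction n arbitrary: T)
  case 0
  then show ?case by auto
next
  case (Suc n)
  have "\<forall>b. \<exists>B. \<forall>hs. length hs = n \<and> (\<forall>h\<in>set hs. norm h \<le> 1) \<longrightarrow> norm (T (b # hs)) \<le> B"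
    using Suc.IH multilinear_on_lists_tail[OF Suc.prems] by blast
  then obtain B where
    B: "\<And>b hs. length hs = n \<Longrightarrow> (\<forall>h\<in>set hs. norm h \<le> 1) \<Longrightarrow> norm (T (b # hs)) \<le> B b"
    by metis
  show ?case
  proof (intro exI allI impI)
    fix hs' :: "'a list"
    assume "length hs' = Suc n \<and> (\<forall>h\<in>set hs'. norm h \<le> 1)"
    then obtain h hs where hs': "hs' = h # hs" and len: "length hs = n" and h: "norm h \<le> 1"
      and hs: "\<forall>h\<in>set hs. norm h \<le> 1"
      by (cases hs') auto
    have lin: "linear (\<lambda>h. T (h # hs))"
      using multilinear_on_lists_head[OF Suc.prems len] .
    have "T ((\<Sum>b\<in>Basis. (h \<bullet> b) *\<^sub>R b) # hs) = (\<Sum>b\<in>Basis. (h \<bullet> b) *\<^sub>R T (b # hs))"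
      using linear_sum[OF lin, of "\<lambda>b. (h \<bullet> b) *\<^sub>R b" Basis] by (simp add: linear_scale[OF lin])
    then have "norm (T hs') \<le> (\<Sum>b\<in>Basis. norm ((h \<bullet> b) *\<^sub>R T (b # hs)))"
      unfolding hs' euclidean_representation by (metis norm_sum)
    also have "\<dots> \<le> (\<Sum>b\<in>Basis. B b)"
    proof (rule sum_mono)
      fix b :: 'a assume "b \<in> Basis"
      then have "\<bar>h \<bullet> b\<bar> \<le> 1"
        using Basis_le_norm[of b h] h by linarith
      then have "\<bar>h \<bullet> b\<bar> * norm (T (b # hs)) \<le> 1 * B b"
        using B[OF len hs] by (intro mult_mono) auto
      then show "norm ((h \<bullet> b) *\<^sub>R T (b # hs)) \<le> B b" by simp
    qed
    finally show "norm (T hs') \<le> (\<Sum>b\<in>Basis. B b)" .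
  qed
qed

lemma norm_le_multi_onorm:
  fixes T :: "'a::euclidean_space list \<Rightarrow> 'b::euclidean_space"
  assumes "multilinear_on_lists n T" and "length hs = n" and "\<forall>h\<in>set hs. norm h \<le> 1"
  shows "norm (T hs) \<le> multi_onorm n T"
  unfolding multi_onorm_def
proof (rule cSUP_upper)
  show "hs \<in> {hs. length hs = n \<and> (\<forall>h\<in>set hs. norm h \<le> 1)}" using assms by simp
  show "bdd_above ((\<lambda>hs. norm (T hs)) ` {hs. length hs = n \<and> (\<forall>h\<in>set hs. norm h \<le> 1)})"
    using multilinear_on_lists_bounded[OF assms(1)] by (fast intro: bdd_aboveI2)
qed

lemma norm_replicate_le_multi_onorm:
  fixes T :: "'a::euclidean_space list \<Rightarrow> 'b::euclidean_space"
  assumes "multilinear_on_lists n T"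
  shows "norm (T (replicate n h)) \<le> multi_onorm n T * norm h ^ n"
proof -
  \<comment> \<open>Homogeneity reduces the claim to \<open>sgn h\<close>, which has norm at most 1
    and is 0 for \<open>h = 0\<close>.\<close>
  have "h = norm h *\<^sub>R sgn h" by (cases "h = 0") (simp_all add: sgn_div_norm)
  then have "T (replicate n h) = norm h ^ n *\<^sub>R T (replicate n (sgn h))"
    using multilinear_on_lists_scale[OF assms, of "norm h" "sgn h"] by metis
  moreover have "norm (T (replicate n (sgn h))) \<le> multi_onorm n T"
    using assms by (intro norm_le_multi_onorm) (auto simp: norm_sgn)
  ultimately show ?thesis
    by (simp add: mult.commute[of "multi_onorm n T"] mult_left_mono)
qed

section \<open>Multilinearity of the higher derivatives\<close>

text \<open>In the head slot this is linearity of a Frechet derivative. In a later slot, linearity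
  at every point is an identity between functions of the base point; differentiating it and using
  uniqueness of derivatives carries it through one more differentiation. Hence the induction keeps
  \<open>x\<close> arbitrary.\<close>

lemma linear_higher_deriv:
  assumes "times_differentiable m F" and "length as + length bs < m"
  shows "linear (\<lambda>h. higher_deriv F (as @ h # bs) x)"
  using assms(2)
proof (induction as arbitrary: x)
  case Nil
  then have "higher_deriv F bs differentiable (at x)"
    using assms(1) by (simp add: times_differentiable_def)
  then show ?case by (simp add: linear_frechet_derivative)
next
  case (Cons a as)
  let ?G = "\<lambda>h. higher_deriv F (as @ h # bs)"
  have lin: "linear (\<lambda>h. ?G h y)" for y using Cons by simp
  have diff: "?G h differentiable (at x)" for h
    using assms(1) Cons.prems by (simp add: times_differentiable_def)
  have add: "?G (h + k) = (\<lambda>y. ?G h y + ?G k y)" for h k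
    using linear_add[OF lin] by blast
  have scale: "?G (c *\<^sub>R h) = (\<lambda>y. c *\<^sub>R ?G h y)" for c h
    using linear_scale[OF lin] by blast
  have D: "(?G h has_derivative frechet_derivative (?G h) (at x)) (at x)" for h
    using diff frechet_derivative_works by blast
  show ?case
  proof (rule linearI)
    fix h k
    have "(?G (h + k) has_derivative
        (\<lambda>u. frechet_derivative (?G h) (at x) u + frechet_derivative (?G k) (at x) u)) (at x)"
      unfolding add by (rule has_derivative_add[OF D D])
    then show "higher_deriv F ((a # as) @ (h + k) # bs) x =
        higher_deriv F ((a # as) @ h # bs) x + higher_deriv F ((a # as) @ k # bs) x"
      by (simp flip: frechet_derivative_at)
  next
    fix c h
    have "(?G (c *\<^sub>R h) has_derivative (\<lambda>u. c *\<^sub>R frechet_derivative (?G h) (at x) u)) (at x)"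
      unfolding scale by (rule has_derivative_scaleR_right[OF D])
    then show "higher_deriv F ((a # as) @ c *\<^sub>R h # bs) x =
        c *\<^sub>R higher_deriv F ((a # as) @ h # bs) x"
      by (simp flip: frechet_derivative_at)
  qed
qed

lemma multilinear_higher_deriv:
  assumes "times_differentiable m F"
  shows "multilinear_on_lists m (\<lambda>hs. higher_deriv F hs x)"
  unfolding multilinear_on_lists_def
  by (intro allI impI linear_higher_deriv[OF assms]) simp

section \<open>Taylor remainder from the Lipschitz condition\<close>

lemma order_lipschitz_replicate:
  assumes "order_lipschitz p L F"
  shows "norm (higher_deriv F (replicate (p - 1) h) y - higher_deriv F (replicate (p - 1) h) x)
           \<le> L * norm (y - x) * norm h ^ (p - 1)"
proof -
  let ?T = "\<lambda>hs. higher_deriv F hs y - higher_deriv F hs x"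
  have "multilinear_on_lists (p - 1) ?T"
    using assms unfolding order_lipschitz_def
    by (intro multilinear_on_lists_diff multilinear_higher_deriv) auto
  then have "norm (?T (replicate (p - 1) h)) \<le> multi_onorm (p - 1) ?T * norm h ^ (p - 1)"
    by (rule norm_replicate_le_multi_onorm)
  also have "\<dots> \<le> L * norm (y - x) * norm h ^ (p - 1)"
    using assms unfolding order_lipschitz_def by (intro mult_right_mono) auto
  finally show ?thesis .
qed

text \<open>The sharp constant is \<open>L / fact p\<close>. The Lagrange remainder at order \<open>p - 1\<close>, applied to the
  component along the error, only gives \<open>L / fact (p - 1)\<close>, which is still half of the weight
  \<open>2 * L / fact (p - 1)\<close> of the regularisation.\<close>

lemma order_lipschitz_taylor:
  fixes F :: "'a::euclidean_space \<Rightarrow> 'b::euclidean_space"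
  assumes "p \<ge> 1" and "L \<ge> 0" and lip: "order_lipschitz p L F"
  shows "norm (F (v + h) - (\<Sum>j<p. (1 / fact j) *\<^sub>R higher_deriv F (replicate j h) v))
           \<le> L / fact (p - 1) * norm h ^ p"
proof -
  define n where "n = p - 1"
  then have p: "p = Suc n" using assms(1) by simp
  define R where "R = F (v + h) - (\<Sum>j<p. (1 / fact j) *\<^sub>R higher_deriv F (replicate j h) v)"
  \<comment> \<open>The Lagrange form holds for scalar functions only, so \<open>F\<close> along the
    segment is projected onto the fixed vector \<open>R\<close>; \<open>f j\<close> is the
    \<open>j\<close>-th derivative of that projection.\<close>
  define f where "f j t = higher_deriv F (replicate j h) (v + t *\<^sub>R h) \<bullet> R" for j and t :: real
  have deriv: "DERIV (f j) t :> f (Suc j) t" if "j < n" for j t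
  proof -
    have "higher_deriv F (replicate j h) differentiable (at (v + t *\<^sub>R h))"
      using lip that by (simp add: order_lipschitz_def times_differentiable_def n_def)
    then have D: "(higher_deriv F (replicate j h) has_derivative
        frechet_derivative (higher_deriv F (replicate j h)) (at (v + t *\<^sub>R h))) (at (v + t *\<^sub>R h))"
      (is "(_ has_derivative ?D) _")
      using frechet_derivative_works by blast
    have "((\<lambda>t. higher_deriv F (replicate j h) (v + t *\<^sub>R h)) has_derivative (\<lambda>u. ?D (u *\<^sub>R h))) (at t)"
      by (rule has_derivative_compose[of "\<lambda>t. v + t *\<^sub>R h", OF _ D])
        (auto intro!: derivative_eq_intros)
    then have "(f j has_derivative (\<lambda>u. ?D (u *\<^sub>R h) \<bullet> R)) (at t)"
      unfolding f_def by (rule has_derivative_inner_left)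
    moreover have "(\<lambda>u. ?D (u *\<^sub>R h) \<bullet> R) = (*) (f (Suc j) t)"
      using linear_scale[OF has_derivative_linear[OF D]] by (auto simp: f_def mult.commute)
    ultimately show ?thesis by (simp add: has_field_derivative_def)
  qed
  \<comment> \<open>The expansion stops at order \<open>n = p - 1\<close>, the last derivative that
    the hypothesis supplies.\<close>
  obtain t where t: "0 < t" "t \<le> 1"
    and eq: "f 0 1 = (\<Sum>j<n. f j 0 / fact j * 1 ^ j) + f n t / fact n * 1 ^ n"
    using Maclaurin2[of 1 f "f 0" n] deriv by auto
  have "R \<bullet> R = f 0 1 - (\<Sum>j<Suc n. f j 0 / fact j)"
    unfolding f_def by (subst R_def) (simp add: inner_diff_left inner_sum_left inner_add_left p)
  \<comment> \<open>The Taylor polynomial in \<open>R\<close> has one more term than the Maclaurin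
    sum; its order \<open>n\<close> term at \<open>v\<close> meets the Lagrange term at
    \<open>t\<close>, leaving a difference to which the Lipschitz bound applies.\<close>
  also have "\<dots> = (f n t - f n 0) / fact n"
    unfolding eq by (simp add: diff_divide_distrib)
  also have "\<dots> \<le> norm (higher_deriv F (replicate n h) (v + t *\<^sub>R h)
      - higher_deriv F (replicate n h) v) * norm R / fact n"
    unfolding f_def by (simp add: divide_right_mono norm_cauchy_schwarz flip: inner_diff_left)
  also have "\<dots> \<le> (L * norm (t *\<^sub>R h) * norm h ^ n) * norm R / fact n"
    using order_lipschitz_replicate[OF lip, of h "v + t *\<^sub>R h" v]
    by (intro divide_right_mono mult_right_mono) (auto simp: n_def)
  also have "\<dots> \<le> (L * norm h * norm h ^ n) * norm R / fact n"
    using t assms(2)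
    by (intro divide_right_mono mult_right_mono mult_left_mono) (auto intro: mult_left_le_one_le)
  also have "\<dots> = (L / fact n * norm h ^ p) * norm R" by (simp add: p)
  finally have "norm R * norm R \<le> (L / fact n * norm h ^ p) * norm R"
    by (simp add: dot_square_norm power2_eq_square)
  \<comment> \<open>This covers \<open>norm R = 0\<close>, where the factor cannot be
    cancelled.\<close>
  moreover have "0 \<le> L / fact n * norm h ^ p" using assms(2) by simp
  ultimately have "norm R \<le> L / fact n * norm h ^ p"
    by (metis mult_right_le_imp_le norm_ge_zero order_le_less)
  then show ?thesis by (simp add: R_def n_def)
qed

section \<open>Zeros of the regularised model\<close>

text \<open>At a zero of the model the Taylor polynomial is minus the regularisation term, so the
  vector on the left is exactly the Taylor remainder.\<close>

lemma reg_taylor_zero_residual: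
  assumes "p \<ge> 1" and "L \<ge> 0" and "order_lipschitz p L F" and "reg_taylor p L F v y = 0"
  shows "norm (F y + (2 * L / fact (p - 1) * norm (y - v) ^ (p - 1)) *\<^sub>R (y - v))
           \<le> L / fact (p - 1) * norm (y - v) ^ p"
proof -
  have "(\<Sum>j<p. (1 / fact j) *\<^sub>R higher_deriv F (replicate j (y - v)) v)
      = - ((2 * L / fact (p - 1) * norm (y - v) ^ (p - 1)) *\<^sub>R (y - v))"
    using assms(4) unfolding reg_taylor_def by (rule eq_neg_iff_add_eq_0[THEN iffD2])
  then show ?thesis
    using order_lipschitz_taylor[OF assms(1-3), of v "y - v"] by simp
qed

text \<open>The factor 3 is 1 from the Taylor remainder plus 2 from the regularisation.\<close>

lemma reg_taylor_zero_norm_le: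
  assumes "p \<ge> 1" and "L \<ge> 0" and "order_lipschitz p L F" and "reg_taylor p L F v y = 0"
  shows "norm (F y) \<le> 3 * L / fact (p - 1) * norm (y - v) ^ p"
proof -
  define d where "d = (2 * L / fact (p - 1) * norm (y - v) ^ (p - 1)) *\<^sub>R (y - v)"
  have "norm d = 2 * L / fact (p - 1) * (norm (y - v) * norm (y - v) ^ (p - 1))"
    using assms(2) by (simp add: d_def)
  also have "norm (y - v) * norm (y - v) ^ (p - 1) = norm (y - v) ^ p"
    using assms(1) by (cases p) auto
  finally have "norm d = 2 * L / fact (p - 1) * norm (y - v) ^ p" .
  moreover have "norm (F y + d) \<le> L / fact (p - 1) * norm (y - v) ^ p"
    using reg_taylor_zero_residual[OF assms] by (simp add: d_def)
  moreover have "norm (F y) \<le> norm (F y + d) + norm d"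
    using norm_triangle_ineq4[of "F y + d" d] by simp
  moreover have "3 * L / fact (p - 1) * norm (y - v) ^ p
      = L / fact (p - 1) * norm (y - v) ^ p + 2 * L / fact (p - 1) * norm (y - v) ^ p"
    by (simp add: field_simps)
  ultimately show ?thesis by linarith
qed

text \<open>The step size cancels the power \<open>norm (y - v) ^ (p - 1)\<close>. With
  \<open>r = norm (y - v)\<close> and \<open>\<beta> = \<eta> * L / fact (p - 1)\<close>, the scaled
  remainder has norm at most \<open>\<beta> * r\<close>, and the scaled regularisation is
  \<open>2 * \<beta>\<close> times \<open>y - v\<close>. The total is
  \<open>\<beta> * r + (1 - 2 * \<beta>) * r\<close>; the last hypothesis makes
  \<open>1 - 2 * \<beta>\<close> nonnegative.\<close>

lemma reg_taylor_zero_inexact_prox: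
  assumes "p \<ge> 1" and "L \<ge> 0" and "order_lipschitz p L F" and "reg_taylor p L F v y = 0"
    and "\<eta> \<ge> 0" and "2 * (\<eta> * L / fact (p - 1)) \<le> 1"
  shows "norm ((\<eta> / norm (y - v) ^ (p - 1)) *\<^sub>R F y + (y - v))
           \<le> (1 - \<eta> * L / fact (p - 1)) * norm (y - v)"
proof (cases "y = v")
  case True
  \<comment> \<open>Both sides then vanish, whatever value the quotient takes.\<close>
  then have "F y = 0"
    using reg_taylor_zero_norm_le[OF assms(1-4)] assms(1) by (simp add: power_0_left)
  with True show ?thesis by simp
next
  case False
  define r where "r = norm (y - v)"
  define \<beta> where "\<beta> = \<eta> * L / fact (p - 1)"
  define E where "E = F y + (2 * L / fact (p - 1) * r ^ (p - 1)) *\<^sub>R (y - v)"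
  have r: "r > 0" using False by (simp add: r_def)
  have rp: "r ^ p = r * r ^ (p - 1)" using assms(1) by (cases p) auto
  have "norm E \<le> L / fact (p - 1) * r ^ p"
    using reg_taylor_zero_residual[OF assms(1-4)] by (simp add: E_def r_def)
  then have "\<eta> / r ^ (p - 1) * norm E \<le> \<eta> / r ^ (p - 1) * (L / fact (p - 1) * r ^ p)"
    using assms(5) r by (intro mult_left_mono) auto
  also have "\<dots> = \<beta> * r" using r by (simp add: \<beta>_def rp)
  finally have E: "norm ((\<eta> / r ^ (p - 1)) *\<^sub>R E) \<le> \<beta> * r"
    using assms(5) r by simp
  have "(\<eta> / r ^ (p - 1)) * (2 * L / fact (p - 1) * r ^ (p - 1)) = 2 * \<beta>"
    using r by (simp add: \<beta>_def)
  then have "(\<eta> / r ^ (p - 1)) *\<^sub>R F y + (y - v) = (\<eta> / r ^ (p - 1)) *\<^sub>R E + (1 - 2 * \<beta>) *\<^sub>R (y - v)"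
    unfolding E_def scaleR_add_right scaleR_scaleR by (simp add: algebra_simps)
  moreover have "norm ((1 - 2 * \<beta>) *\<^sub>R (y - v)) = (1 - 2 * \<beta>) * r"
    using assms(6) by (simp add: \<beta>_def r_def)
  ultimately have "norm ((\<eta> / r ^ (p - 1)) *\<^sub>R F y + (y - v)) \<le> \<beta> * r + (1 - 2 * \<beta>) * r"
    using norm_triangle_mono[OF E order_refl, of "(1 - 2 * \<beta>) *\<^sub>R (y - v)"] by simp
  then show ?thesis by (simp add: r_def \<beta>_def algebra_simps)
qed

section \<open>Decrease of the distance to a zero\<close>

text \<open>The hybrid proximal extragradient estimate: after expanding the square, monotonicity
  between \<open>y\<close> and \<open>z\<close> gives the cross term its sign, and the inexactness
  hypothesis bounds the square of the residual.\<close>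

lemma inexact_prox_step:
  assumes "monotone_operator F" and "F z = 0" and "\<mu> \<ge> 0"
    and "norm (\<mu> *\<^sub>R F y + (y - v)) \<le> q * norm (y - v)"
  shows "(norm (v - \<mu> *\<^sub>R F y - z))\<^sup>2 \<le> (norm (v - z))\<^sup>2 - (1 - q\<^sup>2) * (norm (y - v))\<^sup>2"
proof -
  define g where "g = \<mu> *\<^sub>R F y"
  have "F y \<bullet> (y - z) \<ge> 0"
    using assms(1,2) unfolding monotone_operator_def by (metis diff_zero)
  then have "g \<bullet> (y - z) \<ge> 0" using assms(3) by (simp add: g_def)
  moreover have "(norm (v - g - z))\<^sup>2
      = (norm (v - z))\<^sup>2 - 2 * (g \<bullet> (y - z)) + (norm (g + (y - v)))\<^sup>2 - (norm (y - v))\<^sup>2"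
    by (simp add: power2_norm_eq_inner algebra_simps inner_commute)
  moreover have "(norm (g + (y - v)))\<^sup>2 \<le> (q * norm (y - v))\<^sup>2"
    using assms(4) unfolding g_def by (intro power_mono) auto
  ultimately show ?thesis unfolding g_def by (simp add: power_mult_distrib algebra_simps)
qed

text \<open>Since \<open>fact p / fact (p - 1) = p\<close>, the middle quantity lies between
  \<open>p / (12 * p - 6)\<close> and \<open>p / (4 * p + 2)\<close>. The lower bound keeps the
  inexactness factor below 1, the upper one gives the hypothesis of
  \<open>reg_taylor_zero_inexact_prox\<close>.\<close>

lemma step_size_bounds:
  fixes L \<eta> :: real
  assumes "p \<ge> 1" and "L > 0"
    and lo: "fact p / ((12 * real p - 6) * L) \<le> \<eta>"
    and hi: "\<eta> \<le> fact p / ((4 * real p + 2) * L)"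
  shows "\<eta> > 0" and "1 / 12 \<le> \<eta> * L / fact (p - 1)" and "\<eta> * L / fact (p - 1) \<le> 1 / 4"
proof -
  have f: "(fact p :: real) = real p * fact (p - 1)"
    using assms(1) by (simp add: fact_reduce)
  have p: "real p \<ge> 1" using assms(1) by simp
  have "0 < fact p / ((12 * real p - 6) * L)" using p assms(2) by simp
  with lo show "\<eta> > 0" by linarith
  have "1 / 12 \<le> real p / (12 * real p - 6)" using p by (simp add: field_simps)
  also have "\<dots> = fact p / ((12 * real p - 6) * L) * L / fact (p - 1)"
    using assms(2) by (simp add: f)
  also have "\<dots> \<le> \<eta> * L / fact (p - 1)"
    using lo assms(2) by (intro divide_right_mono mult_right_mono) auto
  finally show "1 / 12 \<le> \<eta> * L / fact (p - 1)" .
  have "\<eta> * L / fact (p - 1) \<le> fact p / ((4 * real p + 2) * L) * L / fact (p - 1)"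
    using hi assms(2) by (intro divide_right_mono mult_right_mono) auto
  also have "\<dots> = real p / (4 * real p + 2)" using assms(2) by (simp add: f)
  also have "\<dots> \<le> 1 / 4" using p by (simp add: field_simps)
  finally show "\<eta> * L / fact (p - 1) \<le> 1 / 4" .
qed

text \<open>Telescopes \<open>inexact_prox_step\<close> with
  \<open>q = 11 / 12 = 1 - 1 / 12\<close>, where \<open>1 - q ^ 2 = 23 / 144\<close>. The distance
  is taken at \<open>x0 + s k\<close> because \<open>v (Suc k)\<close> is unspecified when the run
  stops at \<open>k\<close>.\<close>

lemma high_order_run_sum_sq:
  assumes "p \<ge> 1" and "L > 0" and "monotone_operator F" and "order_lipschitz p L F" and "F z = 0"
    and "fact p / ((12 * real p - 6) * L) \<le> \<eta>" and "\<eta> \<le> fact p / ((4 * real p + 2) * L)"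
    and run: "high_order_run p L \<eta> F x0 N x v s lam" and "enat k \<le> N"
  shows "(norm (x0 + s k - z))\<^sup>2 + 23 / 144 * (\<Sum>i<k. (norm (x (Suc i) - v (Suc i)))\<^sup>2)
           \<le> (norm (x0 - z))\<^sup>2"
  using assms(9)
proof (induction k)
  case 0
  then show ?case using run by (simp add: high_order_run_def)
next
  case (Suc k)
  note eta = step_size_bounds[OF assms(1,2,6,7)]
  have k: "enat k < N" using Suc.prems by (simp add: Suc_ile_eq)
  let ?y = "x (Suc k)" and ?v = "v (Suc k)"
  have v: "x0 + s k = ?v" and zero: "reg_taylor p L F ?v ?y = 0"
    and lam: "lam (Suc k) = \<eta> / norm (?y - ?v) ^ (p - 1)"
    and s: "s (Suc k) = s k - lam (Suc k) *\<^sub>R F ?y"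
    using run k by (auto simp: high_order_run_def)
  have "norm (lam (Suc k) *\<^sub>R F ?y + (?y - ?v)) \<le> (1 - \<eta> * L / fact (p - 1)) * norm (?y - ?v)"
    unfolding lam using assms(2) eta by (intro reg_taylor_zero_inexact_prox assms zero) auto
  also have "\<dots> \<le> 11 / 12 * norm (?y - ?v)"
    using eta by (intro mult_right_mono) auto
  finally have "(norm (?v - lam (Suc k) *\<^sub>R F ?y - z))\<^sup>2
      \<le> (norm (?v - z))\<^sup>2 - (1 - (11 / 12)\<^sup>2) * (norm (?y - ?v))\<^sup>2"
    using eta by (intro inexact_prox_step assms) (simp_all add: lam)
  moreover have "?v - lam (Suc k) *\<^sub>R F ?y = x0 + s (Suc k)"
    using v s by (simp flip: v)
  ultimately have "(norm (x0 + s (Suc k) - z))\<^sup>2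
      \<le> (norm (x0 + s k - z))\<^sup>2 - 23 / 144 * (norm (?y - ?v))\<^sup>2"
    by (simp add: v power_divide)
  moreover have "enat k \<le> N" using k by simp
  ultimately show ?case using Suc.IH by (simp add: algebra_simps)
qed

section \<open>The convergence rate\<close>

text \<open>The least of \<open>k\<close> squares is at most their average, here at most
  \<open>E ^ 2 / k\<close>.\<close>

lemma exists_small_of_sum_sq_le:
  fixes r :: "nat \<Rightarrow> real"
  assumes "k \<ge> 1" and "(\<Sum>i<k. (r i)\<^sup>2) \<le> E\<^sup>2" and "E \<ge> 0"
  shows "\<exists>i<k. r i \<le> E * real k powr (- (1 / 2))"
proof (rule ccontr)
  assume "\<not> ?thesis"
  then have *: "E * real k powr (- (1 / 2)) < r i" if "i < k" for i
    using that by force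
  have "E\<^sup>2 = (\<Sum>i<k. (E * real k powr (- (1 / 2)))\<^sup>2)"
    using assms(1) by (simp add: power_mult_distrib powr_minus powr_half_sqrt power_inverse)
  also have "\<dots> < (\<Sum>i<k. (r i)\<^sup>2)"
    using assms(1,3) *
    by (intro sum_strict_mono power_strict_mono) (auto simp: lessThan_empty_iff)
  finally show False using assms(2) by simp
qed

theorem theorem3p3:
  fixes F :: "real ^ 'd \<Rightarrow> real ^ 'd" and p :: nat and L \<eta>1 :: real
    and x0 :: "real ^ 'd" and N :: enat
    and x v s :: "nat \<Rightarrow> real ^ 'd" and lam :: "nat \<Rightarrow> real"
  assumes "p \<ge> 1" and "L > 0"
    and "monotone_operator F"
    and "order_lipschitz p L F"
    and "\<exists>z. F z = 0"
    and "fact p / ((12 * real p - 6) * L) \<le> \<eta>1"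
    and "\<eta>1 \<le> fact p / ((4 * real p + 2) * L)"
    and "high_order_run p L \<eta>1 F x0 N x v s lam"
  shows "\<exists>C>0. \<forall>k\<ge>1.
           (INF i\<in>{i. i \<le> k \<and> enat i \<le> N}. norm (F (x i))) \<le> C * real k powr (- (real p / 2))"
proof -
  obtain z where z: "F z = 0" using assms(5) by blast
  define A where "A = 3 * L / fact (p - 1)"
  have A: "A > 0" using assms(2) by (simp add: A_def)
  define E where "E = sqrt (144 / 23) * norm (x0 - z)"
  have E: "E \<ge> 0" by (simp add: E_def)
  have E2: "E\<^sup>2 = 144 / 23 * (norm (x0 - z))\<^sup>2"
    by (simp add: E_def power_mult_distrib)
  \<comment> \<open>The summand 1 keeps \<open>C\<close> positive when \<open>x0 = z\<close>, where
    \<open>E\<close> is 0.\<close>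
  define C where "C = A * E ^ p + 1"
  have C: "C > 0" using A E by (simp add: C_def add_nonneg_pos)
  have "(INF i\<in>{i. i \<le> k \<and> enat i \<le> N}. norm (F (x i))) \<le> C * real k powr (- (real p / 2))"
    if k: "k \<ge> 1" for k
  proof -
    \<comment> \<open>With this, one good index bounds the infimum.\<close>
    have bdd: "bdd_below ((\<lambda>i. norm (F (x i))) ` {i. i \<le> k \<and> enat i \<le> N})"
      by (rule bdd_belowI2[where m = 0]) simp
    have "\<exists>i. i \<le> k \<and> enat i \<le> N \<and> norm (F (x i)) \<le> C * real k powr (- (real p / 2))"
    proof (cases "enat k \<le> N")
      case True
      have "23 / 144 * (\<Sum>i<k. (norm (x (Suc i) - v (Suc i)))\<^sup>2) \<le> (norm (x0 - z))\<^sup>2"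
        using high_order_run_sum_sq[OF assms(1-4) z assms(6-8) True]
          zero_le_power2[of "norm (x0 + s k - z)"] by linarith
      then have sum: "(\<Sum>i<k. (norm (x (Suc i) - v (Suc i)))\<^sup>2) \<le> E\<^sup>2" by (simp add: E2)
      obtain i where i: "i < k"
        and r: "norm (x (Suc i) - v (Suc i)) \<le> E * real k powr (- (1 / 2))"
        using exists_small_of_sum_sq_le[OF k sum E] by blast
      \<comment> \<open>The short step with index \<open>i < k\<close> ends at the iterate
        \<open>Suc i\<close>, which is still at most \<open>k\<close>.\<close>
      have iN: "enat (Suc i) \<le> N"
        using i True by (meson Suc_leI enat_ord_simps(1) order_trans)
      then have "reg_taylor p L F (v (Suc i)) (x (Suc i)) = 0"
        using assms(8) unfolding high_order_run_def Suc_ile_eq by blast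
      then have "norm (F (x (Suc i))) \<le> A * norm (x (Suc i) - v (Suc i)) ^ p"
        unfolding A_def using assms by (intro reg_taylor_zero_norm_le) auto
      also have "\<dots> \<le> A * (E * real k powr (- (1 / 2))) ^ p"
        using A r by (intro mult_left_mono power_mono) auto
      also have "\<dots> = A * E ^ p * real k powr (- (real p / 2))"
        using k by (simp add: power_mult_distrib powr_power)
      also have "\<dots> \<le> C * real k powr (- (real p / 2))"
        by (intro mult_right_mono) (simp_all add: C_def)
      finally show ?thesis using i iN by (intro exI[of _ "Suc i"]) simp
    next
      case False
      \<comment> \<open>The run stopped before \<open>k\<close>, so the zero it found is among the
        admissible iterates.\<close>
      then obtain n where n: "N = enat n" "n < k" by (cases N) auto
      then have "F (x n) = 0" using assms(8) by (simp add: high_order_run_def)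
      then show ?thesis using n C by (intro exI[of _ n]) simp
    qed
    then obtain i where "i \<in> {i. i \<le> k \<and> enat i \<le> N}"
      and "norm (F (x i)) \<le> C * real k powr (- (real p / 2))" by blast
    then show ?thesis using cINF_lower[OF bdd] by (meson order_trans)
  qed
  with C show ?thesis by blast
qed

end
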